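(* Let $W$ be a nonnegative random variable with $\mathbb{E}W=1$ and let $W^e$ be a random variable, defined on the same probability space as $W$, having the equilibrium distribution with respect to $W$. Then, for any $\beta>0$, $$d_{\mathrm K}(\mathcal{L}(W),\mathrm{Exp}(1))\le 12\beta+2\,\mathbb{P}[|W^e-W|>\beta]$$ and $$d_{\mathrm K}(\mathcal{L}(W^e),\mathrm{Exp}(1))\le \beta+\mathbb{P}[|W^e-W|>\beta].$$ If in addition $W$ has finite second moment, then $$d_{\mathrm W}(\mathcal{L}(W),\mathrm{Exp}(1))\le 2\,\mathbb{E}|W^e-W|$$ and $$d_{\mathrm K}(\mathcal{L}(W^e),\mathrm{Exp}(1))\le \mathbb{E}|W^e-W|,\qquad d_{\mathrm W}(\mathcal{L}(W^e),\mathrm{Exp}(1))\le \mathbb{E}|W^e-W|.$$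
   Context: $\mathcal{L}(X)$ denotes the law of $X$; $\mathrm{Exp}(1)$ is the exponential distribution with mean $1$. For probability measures $P,Q$ on $\mathbb{R}$ and a class $\mathcal{F}$ of test functions, $d_{\mathcal F}(P,Q)=\sup_{f\in\mathcal F}|\int f\,dP-\int f\,dQ|$. The Kolmogorov distance $d_{\mathrm K}$ uses $\mathcal F_{\mathrm K}=\{\mathbf 1[\,\cdot\le z]: z\in\mathbb{R}\}$; the Wasserstein distance $d_{\mathrm W}$ uses $\mathcal F_{\mathrm W}$, the set of Lipschitz $h:\mathbb{R}\to\mathbb{R}$ with Lipschitz constant at most $1$. Equilibrium distribution: for a nonnegative random variable $X$ with finite mean, a random variable $X^e$ has the equilibrium distribution with respect to $X$ if $\mathbb{E}f(X)-f(0)=\mathbb{E}X\;\mathbb{E}f'(X^e)$ for all Lipschitz $f$; for $\mathbb{E}X>0$ this means $\mathbb{P}(X^e\le x)=\frac{1}{\mathbb{E}X}\int_0^x\mathbb{P}[X>y]\,dy$ for $x\ge 0$. *)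

theory Defs
  imports "HOL-Probability.Probability"
begin

text \<open>
  The supremum is taken in \<^typ>\<open>ennreal\<close>, so an unbounded family gives \<open>\<infinity>\<close>. Bochner integrals of
  non-integrable functions are 0; for the Wasserstein class the distance is therefore meaningful
  only for measures with finite first moment.
\<close>

definition test_dist :: "(real \<Rightarrow> real) set \<Rightarrow> real measure \<Rightarrow> real measure \<Rightarrow> ennreal" where
  "test_dist F P Q = (SUP f\<in>F. ennreal \<bar>(\<integral>x. f x \<partial>P) - (\<integral>x. f x \<partial>Q)\<bar>)"

definition kolmogorov_class :: "(real \<Rightarrow> real) set" where
  "kolmogorov_class = {indicator {..z} | z. True}"

definition wasserstein_class :: "(real \<Rightarrow> real) set" where
  "wasserstein_class = {h. 1-lipschitz_on UNIV h}"

definition d_K :: "real measure \<Rightarrow> real measure \<Rightarrow> ennreal" where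
  "d_K = test_dist kolmogorov_class"

definition d_W :: "real measure \<Rightarrow> real measure \<Rightarrow> ennreal" where
  "d_W = test_dist wasserstein_class"

definition law :: "'a measure \<Rightarrow> ('a \<Rightarrow> real) \<Rightarrow> real measure" where
  "law M X = distr M borel X"

definition Exp1 :: "real measure" where
  "Exp1 = density lborel (exponential_density 1)"

text \<open>
  A Lipschitz function is differentiable off a Lebesgue-null set; at the exceptional points
  \<^term>\<open>deriv f\<close> is a fixed unspecified constant, so it is bounded and Borel. The
  smooth \<open>f\<close> alone already force the distribution function
  \<open>(1 / \<E>X) * (\<integral>y\<in>{0..x}. \<P>(X > y))\<close> when \<open>\<E>X > 0\<close>; in particular \<open>Xe\<close> is then absolutely
  continuous and the exceptional points do not contribute.
\<close>

definition has_equilibrium_distribution ::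
  "'b measure \<Rightarrow> ('b \<Rightarrow> real) \<Rightarrow> 'a measure \<Rightarrow> ('a \<Rightarrow> real) \<Rightarrow> bool" where
  "has_equilibrium_distribution N Xe M X \<longleftrightarrow>
     (\<forall>f :: real \<Rightarrow> real. (\<exists>C. C-lipschitz_on UNIV f) \<longrightarrow>
        (\<integral>\<omega>. f (X \<omega>) \<partial>M) - f 0 = (\<integral>\<omega>. X \<omega> \<partial>M) * (\<integral>\<omega>. deriv f (Xe \<omega>) \<partial>N))"

end

theory Submission
  imports Defs "HOL-Real_Asymp.Real_Asymp"
begin

text \<open>
  Stein's method. Let \<open>Z\<close> be \<open>Exp(1)\<close> distributed. The equation \<open>f' - f = h - \<E> h(Z)\<close> with \<open>f(0) = 0\<close>
  is solved by \<open>f(x) = \<E> h(Z) - \<E> h(x + Z)\<close>, which is 1-Lipschitz both for 1-Lipschitz \<open>h\<close> and for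
  \<open>h = 1[\<cdot> \<le> z]\<close>; in the latter case \<open>f\<close> also takes values in an interval of length 1. The
  equilibrium identity \<open>\<E> f(W) = \<E> f'(We)\<close> turns the equation into
  \<open>\<E> h(We) - \<E> h(Z) = \<E> (f(W) - f(We))\<close>, which gives all bounds for \<open>We\<close>.

  The bounds for \<open>W\<close> follow from those for \<open>We\<close>: in the Wasserstein case by the triangle inequality,
  in the Kolmogorov case from \<open>P(W \<le> z) \<le> P(We \<le> z + \<beta>) + P(|We - W| > \<beta>)\<close>, its mirror image, and
  the fact that the distribution function of \<open>Z\<close> is 1-Lipschitz. This avoids smoothing the indicator
  and yields the constant 2 in place of 12.
\<close>

section \<open>Elementary estimates for Lipschitz functions and exponentials\<close>

lemma lipschitz_on_of_real_derivative:
  fixes f f' :: "real \<Rightarrow> real"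
  assumes "\<And>x. (f has_real_derivative f' x) (at x)" "\<And>x. \<bar>f' x\<bar> \<le> C"
  shows "C-lipschitz_on UNIV f"
proof (rule lipschitz_onI)
  show "0 \<le> C" using assms(2)[of 0] by linarith
  show "dist (f x) (f y) \<le> C * dist x y" for x y
    using field_differentiable_bound[of UNIV f f' C x y] assms by (simp add: dist_norm)
qed

text \<open>Factoring out \<open>exp (- s)\<close>, which is at most 1, leaves
  \<open>1 - exp (- r)\<close> with \<open>r = t - s\<close>, and the tangent of \<open>exp\<close>
  at 0 bounds this by \<open>r\<close>. Both the distribution function of Exp(1) and the Stein
  solution for indicators need the estimate.\<close>

lemma exp_uminus_diff_le:
  fixes s t :: real
  assumes "0 \<le> s" "s \<le> t"
  shows "exp (- s) - exp (- t) \<le> t - s"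
proof -
  have "exp (- t) = exp (- s) * exp (- (t - s))" by (simp flip: exp_add)
  then have "exp (- s) - exp (- t) = exp (- s) * (1 - exp (- (t - s)))"
    by (simp add: right_diff_distrib)
  also have "1 - exp (- (t - s)) \<le> t - s"
    using exp_ge_add_one_self[of "- (t - s)"] by linarith
  then have "exp (- s) * (1 - exp (- (t - s))) \<le> 1 * (t - s)"
    using assms by (intro mult_mono) auto
  finally show ?thesis by simp
qed

text \<open>A Lipschitz function grows at most linearly:
  \<open>\<bar>f 0\<bar> + C * \<bar>X \<omega>\<bar>\<close> is an integrable majorant.\<close>

lemma integrable_lipschitz_comp:
  fixes f :: "real \<Rightarrow> real"
  assumes "finite_measure M" and f: "C-lipschitz_on UNIV f" and X: "integrable M X"
  shows "integrable M (\<lambda>\<omega>. f (X \<omega>))"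
proof -
  interpret finite_measure M by fact
  have [measurable]: "f \<in> borel_measurable borel"
    using lipschitz_on_continuous_on[OF f] by (rule borel_measurable_continuous_onI)
  have [measurable]: "X \<in> borel_measurable M" using X by auto
  have le: "norm (f (X \<omega>)) \<le> norm (\<bar>f 0\<bar> + C * \<bar>X \<omega>\<bar>)" for \<omega>
    using lipschitz_onD[OF f, of "X \<omega>" 0] lipschitz_on_nonneg[OF f] by (simp add: dist_real_def)
  have "integrable M (\<lambda>\<omega>. \<bar>f 0\<bar> + C * \<bar>X \<omega>\<bar>)" using X by simp
  then show ?thesis
    by (rule Bochner_Integration.integrable_bound) (measurable, intro AE_I2 le)
qed

section \<open>The exponential distribution\<close>

lemma prob_space_Exp1: "prob_space Exp1"
  unfolding Exp1_def by (rule prob_space_exponential_density) simp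

lemma sets_Exp1 [measurable_cong, simp]: "sets Exp1 = sets borel"
  by (simp add: Exp1_def)

lemma space_Exp1 [simp]: "space Exp1 = UNIV"
  by (simp add: Exp1_def)

lemma distributed_Exp1: "distributed Exp1 lborel (\<lambda>x. x) (exponential_density 1)"
  by (auto simp: distributed_def Exp1_def distr_id2 exponential_density_nonneg)

lemma measure_Exp1_atMost: "measure Exp1 {..z} = (if z < 0 then 0 else 1 - exp (- z))"
proof -
  interpret E: prob_space Exp1 by (rule prob_space_Exp1)
  have *: "measure Exp1 {..z} = 1 - exp (- z)" if "0 \<le> z" for z
    using E.exponential_distributedD_le[OF distributed_Exp1 that] by (simp add: atMost_def)
  \<comment> \<open>By the formula just shown, the half-line up to 0 has mass
    \<open>1 - exp 0 = 0\<close>.\<close>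
  have "measure Exp1 {..z} \<le> measure Exp1 {..0}" if "z < 0"
    using that by (intro E.finite_measure_mono) auto
  then show ?thesis
    using *[of 0] *[of z] measure_nonneg[of Exp1 "{..z}"] by (cases "z < 0") auto
qed

lemma measure_Exp1_atMost_shift:
  assumes "0 \<le> b"
  shows "measure Exp1 {..z + b} \<le> measure Exp1 {..z} + b"
  \<comment> \<open>The second instance, starting at 0, handles \<open>z < 0 \<le> z + b\<close>:
    the mass up to \<open>z\<close> is then 0, and \<open>z + b \<le> b\<close>.\<close>
  using assms exp_uminus_diff_le[of z "z + b"] exp_uminus_diff_le[of 0 "z + b"]
  by (auto simp: measure_Exp1_atMost)

text \<open>The Bochner integral of a non-integrable function is 0, so a mean of 1 forces
  integrability.\<close>

lemma integrable_Exp1_ident: "integrable Exp1 (\<lambda>x. x)"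
proof -
  interpret E: prob_space Exp1 by (rule prob_space_Exp1)
  have "E.expectation (\<lambda>x. x) = 1"
    using E.exponential_distributed_expectation[OF _ distributed_Exp1] by simp
  then show ?thesis using not_integrable_integral_eq[of Exp1 "\<lambda>x. x"] by (cases rule: ccontr) simp
qed

lemma integral_Exp1_eq_lborel:
  assumes [measurable]: "f \<in> borel_measurable borel"
  shows "(\<integral>u. f u \<partial>Exp1) = (\<integral>u. indicator {0..} u * (exp (- u) * f u) \<partial>lborel)"
  unfolding Exp1_def
  by (subst integral_density)
    (auto simp: exponential_density_nonneg exponential_density_def indicator_def
      intro!: Bochner_Integration.integral_cong)

lemma integrable_Exp1_iff_lborel:
  assumes [measurable]: "f \<in> borel_measurable borel"
  shows "integrable Exp1 f \<longleftrightarrow> integrable lborel (\<lambda>u. indicator {0..} u * (exp (- u) * f u))"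
  unfolding Exp1_def
  by (subst integrable_density)
    (auto simp: exponential_density_nonneg exponential_density_def indicator_def
      intro!: Bochner_Integration.integrable_cong)

section \<open>The Stein solution for Lipschitz test functions\<close>

text \<open>For 1-Lipschitz \<open>h\<close>, the Stein solution vanishing at 0 is
  \<open>exp_shift h 0 - exp_shift h x\<close>. Using \<open>exp_shift h\<close> itself changes only
  the sign and an additive constant.\<close>

definition exp_shift :: "(real \<Rightarrow> real) \<Rightarrow> real \<Rightarrow> real" where
  "exp_shift h x = (\<integral>u. h (x + u) \<partial>Exp1)"

context
  fixes h :: "real \<Rightarrow> real"
  assumes h: "1-lipschitz_on UNIV h"
begin

lemma measurable_lipschitz [measurable]: "h \<in> borel_measurable borel"
  using lipschitz_on_continuous_on[OF h] by (rule borel_measurable_continuous_onI)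

lemma integrable_exp_shift: "integrable Exp1 (\<lambda>u. h (x + u))"
proof -
  interpret E: prob_space Exp1 by (rule prob_space_Exp1)
  have "integrable Exp1 (\<lambda>u. x + u)" using integrable_Exp1_ident by simp
  from integrable_lipschitz_comp[OF E.finite_measure_axioms h this] show ?thesis .
qed

text \<open>Every translate of \<open>h\<close> is 1-Lipschitz, and averaging over a probability
  measure preserves this.\<close>

lemma lipschitz_exp_shift: "1-lipschitz_on UNIV (exp_shift h)"
proof (rule lipschitz_onI)
  interpret E: prob_space Exp1 by (rule prob_space_Exp1)
  fix x y :: real
  have "\<bar>exp_shift h x - exp_shift h y\<bar> = \<bar>\<integral>u. h (x + u) - h (y + u) \<partial>Exp1\<bar>"
    by (simp add: exp_shift_def integrable_exp_shift)
  also have "\<dots> \<le> (\<integral>u. \<bar>h (x + u) - h (y + u)\<bar> \<partial>Exp1)"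
    by (rule integral_abs_bound)
  also have "\<dots> \<le> (\<integral>u. \<bar>x - y\<bar> \<partial>Exp1)"
  proof (rule integral_mono)
    show "\<bar>h (x + u) - h (y + u)\<bar> \<le> \<bar>x - y\<bar>" for u
      using lipschitz_onD[OF h, of "x + u" "y + u"] by (simp add: dist_real_def)
  qed (auto simp: integrable_exp_shift)
  also have "\<dots> = \<bar>x - y\<bar>" using E.prob_space by simp
  finally show "dist (exp_shift h x) (exp_shift h y) \<le> 1 * dist x y"
    by (simp add: dist_real_def)
qed simp

text \<open>The substitution \<open>t = x + u\<close> takes \<open>x\<close> out of the argument of
  \<open>h\<close>. What remains is a prefactor \<open>exp x\<close> and a lower limit of
  integration, both of which can be differentiated in \<open>x\<close> although \<open>h\<close> is
  merely Lipschitz.\<close>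

lemma tail_integrable: "integrable lborel (\<lambda>t. indicator {x..} t * (exp (- t) * h t))"
  and exp_shift_eq_tail:
    "exp_shift h x = exp x * (\<integral>t. indicator {x..} t * (exp (- t) * h t) \<partial>lborel)"
proof -
  let ?k = "\<lambda>t. indicator {x..} t * (exp (x - t) * h t)"
  have eq: "?k (x + 1 * u) = indicator {0..} u * (exp (- u) * h (x + u))" for u
    by (auto simp: indicator_def)
  have "integrable lborel (\<lambda>u. ?k (x + 1 * u))"
    unfolding eq using integrable_exp_shift[of x] by (subst (asm) integrable_Exp1_iff_lborel) auto
  then have "integrable lborel ?k"
    by (subst (asm) lborel_integrable_real_affine_iff) auto
  then have "integrable lborel (\<lambda>t. exp (- x) * ?k t)" by (rule integrable_mult_right)
  also have "(\<lambda>t. exp (- x) * ?k t) = (\<lambda>t. indicator {x..} t * (exp (- t) * h t))"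
    by (rule ext) (simp add: exp_diff exp_minus field_simps)
  finally show "integrable lborel (\<lambda>t. indicator {x..} t * (exp (- t) * h t))" .
  have "exp_shift h x = (\<integral>u. ?k (x + 1 * u) \<partial>lborel)"
    unfolding eq exp_shift_def by (subst integral_Exp1_eq_lborel) auto
  also have "\<dots> = (\<integral>t. ?k t \<partial>lborel)"
    using lborel_integral_real_affine[of 1 ?k x] by simp
  also have "?k = (\<lambda>t. exp x * (indicator {x..} t * (exp (- t) * h t)))"
    by (rule ext) (simp add: exp_diff exp_minus field_simps)
  finally show "exp_shift h x = exp x * (\<integral>t. indicator {x..} t * (exp (- t) * h t) \<partial>lborel)"
    by simp
qed

text \<open>Product rule on the tail formula: differentiating the prefactor reproduces
  \<open>exp_shift h x\<close>, and the fundamental theorem of calculus applied to the lower limit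
  contributes \<open>- h x\<close>.\<close>

lemma exp_shift_has_derivative:
  "(exp_shift h has_real_derivative exp_shift h x - h x) (at x)"
proof -
  let ?k = "\<lambda>t. exp (- t) * h t"
  let ?A = "\<lambda>a. \<integral>t. indicator {a..} t * ?k t \<partial>lborel"
  \<comment> \<open>Any base point left of \<open>x\<close> would do; it makes \<open>x\<close>
    interior to \<open>{a..x+1}\<close>, so the one-sided derivative becomes two-sided.\<close>
  define a where "a = x - 1"
  have cont: "continuous_on S ?k" for S
    using lipschitz_on_continuous_on[OF h]
    by (intro continuous_intros) (auto intro: continuous_on_subset)
  have split: "?A y = ?A a - integral {a..y} ?k" if "a \<le> y" for y
  proof -
    have si: "set_integrable lborel {a..y} ?k"
      by (rule borel_integrable_compact[OF compact_Icc cont, unfolded set_integrable_def[symmetric]])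
    have "?A a = (\<integral>t. indicator {a..y} t * ?k t + indicator {y..} t * ?k t \<partial>lborel)"
    proof (rule integral_cong_AE)
      \<comment> \<open>The two pieces overlap only at the null point \<open>y\<close>.\<close>
      show "AE t in lborel. indicator {a..} t * ?k t = indicator {a..y} t * ?k t + indicator {y..} t * ?k t"
        using AE_lborel_singleton[of y] by eventually_elim (use that in \<open>auto simp: indicator_def\<close>)
    qed auto
    also have "\<dots> = (LINT t:{a..y}|lborel. ?k t) + ?A y"
      using si tail_integrable[of y]
      by (subst Bochner_Integration.integral_add) (auto simp: set_integrable_def set_lebesgue_integral_def)
    finally show ?thesis using set_borel_integral_eq_integral(2)[OF si] by simp
  qed
  have "((\<lambda>y. integral {a..y} ?k) has_real_derivative ?k x) (at x within {a..x+1})"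
    by (rule integral_has_real_derivative[OF cont]) (auto simp: a_def)
  then have D: "((\<lambda>y. integral {a..y} ?k) has_real_derivative ?k x) (at x)"
    by (subst (asm) at_within_interior) (auto simp: a_def)
  have "((\<lambda>y. exp y * (?A a - integral {a..y} ?k)) has_real_derivative
      exp x * (?A a - integral {a..x} ?k) - exp x * ?k x) (at x)"
    by (rule derivative_eq_intros D refl)+ simp
  moreover have "exp x * (?A a - integral {a..x} ?k) - exp x * ?k x = exp_shift h x - h x"
    using split[of x] by (simp add: exp_shift_eq_tail a_def exp_minus)
  ultimately have "((\<lambda>y. exp y * (?A a - integral {a..y} ?k)) has_real_derivative
      exp_shift h x - h x) (at x)" by simp
  then show ?thesis
  proof (rule has_field_derivative_transform_within_open[of _ _ _ "{a<..}"])
    fix y assume "y \<in> {a<..}"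
    then show "exp y * (?A a - integral {a..y} ?k) = exp_shift h y"
      using split[of y] exp_shift_eq_tail[of y] by simp
  qed (auto simp: a_def)
qed

end

section \<open>Regularity of the equilibrium variable\<close>

locale equilibrium_coupling = prob_space M for M :: "'a measure" +
  fixes W We :: "'a \<Rightarrow> real"
  assumes W_meas [measurable]: "W \<in> borel_measurable M"
    and W_nonneg: "AE \<omega> in M. 0 \<le> W \<omega>"
    and W_int: "integrable M W"
    and W_mean: "(\<integral>\<omega>. W \<omega> \<partial>M) = 1"
    and We_meas [measurable]: "We \<in> borel_measurable M"
    and We_equilibrium: "has_equilibrium_distribution M We M W"
begin

lemma integrable_lipschitz_W:
  fixes f :: "real \<Rightarrow> real"
  shows "C-lipschitz_on UNIV f \<Longrightarrow> integrable M (\<lambda>\<omega>. f (W \<omega>))"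
  using integrable_lipschitz_comp[OF finite_measure_axioms _ W_int] .

lemma expectation_eq_deriv:
  assumes "C-lipschitz_on UNIV f"
  shows "expectation (\<lambda>\<omega>. f (W \<omega>)) - f 0 = expectation (\<lambda>\<omega>. deriv f (We \<omega>))"
  using We_equilibrium assms W_mean by (auto simp: has_equilibrium_distribution_def)

text \<open>Test functions \<open>\<epsilon> arctan ((x - z) / \<epsilon>)\<close>: small in sup norm, with derivative 1 at \<open>z\<close>.\<close>

lemma We_no_atom: "AE \<omega> in M. We \<omega> \<noteq> z"
proof -
  have bound: "prob {\<omega> \<in> space M. We \<omega> = z} \<le> e" if "e > 0" for e
  proof -
    \<comment> \<open>With this scale the sup norm of \<open>f\<close> is at most
      \<open>d * pi / 2 = e / 2\<close>, so \<open>f (W \<omega>)\<close> and \<open>f 0\<close>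
      together cost at most \<open>e\<close>.\<close>
    define d where "d = e / pi"
    have d: "d > 0" using that by (simp add: d_def)
    define f where "f = (\<lambda>x. d * arctan ((x - z) / d))"
    define f' where "f' = (\<lambda>x. inverse (1 + ((x - z) / d)\<^sup>2))"
    have D: "(f has_real_derivative f' x) (at x)" for x
      unfolding f_def f'_def using d by (auto intro!: derivative_eq_intros)
    have f'_bounds: "0 \<le> f' x" "f' x \<le> 1" for x
      by (auto simp: f'_def inverse_le_1_iff)
    have [measurable]: "f' \<in> borel_measurable borel" unfolding f'_def by measurable
    have lip: "1-lipschitz_on UNIV f"
      by (rule lipschitz_on_of_real_derivative[OF D]) (use f'_bounds in auto)
    have f_bound: "\<bar>f x\<bar> \<le> e / 2" for x
    proof -
      have "\<bar>arctan ((x - z) / d)\<bar> \<le> pi / 2"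
        using arctan_bounded[of "(x - z) / d"] by linarith
      then have "d * \<bar>arctan ((x - z) / d)\<bar> \<le> d * (pi / 2)" using d by simp
      also have "d * (pi / 2) = e / 2" by (simp add: d_def)
      finally show ?thesis using d by (simp add: f_def abs_mult)
    qed
    have int: "integrable M (\<lambda>\<omega>. f' (We \<omega>))"
      by (rule integrable_const_bound[of _ 1]) (use f'_bounds in auto)
    have "prob {\<omega> \<in> space M. We \<omega> = z} = expectation (indicator {\<omega> \<in> space M. We \<omega> = z})"
      by simp
    also have "\<dots> \<le> expectation (\<lambda>\<omega>. f' (We \<omega>))"
    proof (rule integral_mono[OF _ int])
      show "indicator {\<omega> \<in> space M. We \<omega> = z} \<omega> \<le> f' (We \<omega>)" for \<omega>
        using f'_bounds[of "We \<omega>"] by (auto simp: indicator_def f'_def)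
    qed (auto simp: emeasure_eq_measure)
    also have "\<dots> = expectation (\<lambda>\<omega>. f (W \<omega>)) - f 0"
      using expectation_eq_deriv[OF lip] DERIV_imp_deriv[OF D] by simp
    also have "\<dots> \<le> expectation (\<lambda>\<omega>. e / 2) + e / 2"
    proof -
      have "expectation (\<lambda>\<omega>. f (W \<omega>)) \<le> expectation (\<lambda>\<omega>. e / 2)"
        by (intro integral_mono integrable_lipschitz_W[OF lip] abs_le_D1[OF f_bound]) simp
      then show ?thesis using f_bound[of 0] by linarith
    qed
    finally show ?thesis using prob_space by simp
  qed
  have "prob {\<omega> \<in> space M. We \<omega> = z} = 0"
    using field_le_epsilon[of "prob {\<omega> \<in> space M. We \<omega> = z}" 0] bound measure_nonneg
    by (simp add: order.antisym)
  then show ?thesis by (subst AE_iff_measurable[OF _ refl]) (auto simp: emeasure_eq_measure)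
qed

text \<open>This admits test functions with one kink. At \<open>z\<close> the value of
  \<open>deriv f\<close> is uncontrolled, but \<open>We\<close> has no atom there, so any Borel
  version \<open>f'\<close> of the derivative gives the same expectation.\<close>

lemma expectation_eq_derivative:
  assumes lip: "C-lipschitz_on UNIV f"
    and [measurable]: "f' \<in> borel_measurable borel"
    and D: "\<And>x. x \<noteq> z \<Longrightarrow> (f has_real_derivative f' x) (at x)"
  shows "expectation (\<lambda>\<omega>. f (W \<omega>)) - f 0 = expectation (\<lambda>\<omega>. f' (We \<omega>))"
proof -
  have eq: "deriv f x = (if x = z then deriv f z else f' x)" for x
    using DERIV_imp_deriv[OF D] by auto
  have "expectation (\<lambda>\<omega>. f (W \<omega>)) - f 0 =
      expectation (\<lambda>\<omega>. if We \<omega> = z then deriv f z else f' (We \<omega>))"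
    unfolding expectation_eq_deriv[OF lip] by (subst eq) simp
  also have "\<dots> = expectation (\<lambda>\<omega>. f' (We \<omega>))"
  proof (rule integral_cong_AE)
    show "AE \<omega> in M. (if We \<omega> = z then deriv f z else f' (We \<omega>)) = f' (We \<omega>)"
      using We_no_atom[of z] by eventually_elim auto
  qed auto
  finally show ?thesis .
qed

text \<open>Test the equilibrium identity with the positive part: it leaves \<open>W\<close>
  unchanged almost surely, and its derivative is the indicator of the positive half-line, so the
  probability in question equals the mean 1 of \<open>W\<close>.\<close>

lemma We_pos: "AE \<omega> in M. 0 < We \<omega>"
proof -
  have lip: "1-lipschitz_on UNIV (\<lambda>x::real. max 0 x)"
    by (rule lipschitz_onI) (auto simp: dist_real_def)
  have "expectation (\<lambda>\<omega>. max 0 (W \<omega>)) - max 0 0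
      = expectation (\<lambda>\<omega>. indicator {0<..} (We \<omega>))"
  proof (rule expectation_eq_derivative[OF lip, where z = 0])
    fix x :: real assume "x \<noteq> 0"
    then consider "x < 0" | "0 < x" by linarith
    then show "(max 0 has_real_derivative indicator {0<..} x) (at x)"
    proof cases
      case 1
      have "((\<lambda>x. 0) has_real_derivative indicator {0<..} x) (at x)" using 1 by simp
      then show ?thesis
        by (rule has_field_derivative_transform_within_open[of _ _ _ "{..<0}"]) (use 1 in auto)
    next
      case 2
      have "((\<lambda>x. x) has_real_derivative indicator {0<..} x) (at x)" using 2 by simp
      then show ?thesis
        by (rule has_field_derivative_transform_within_open[of _ _ _ "{0<..}"]) (use 2 in auto)
    qed
  qed auto
  moreover have "expectation (\<lambda>\<omega>. max 0 (W \<omega>)) = expectation W"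
    using W_nonneg by (intro integral_cong_AE) auto
  moreover have "expectation (\<lambda>\<omega>. indicator {0<..} (We \<omega>)) = prob {\<omega> \<in> space M. 0 < We \<omega>}"
  proof -
    have "expectation (\<lambda>\<omega>. indicat_real {0<..} (We \<omega>))
        = expectation (indicat_real {\<omega> \<in> space M. 0 < We \<omega>})"
      by (intro Bochner_Integration.integral_cong) (auto simp: indicator_def)
    then show ?thesis by simp
  qed
  ultimately have "prob {\<omega> \<in> space M. 0 < We \<omega>} = 1" using W_mean by simp
  then show ?thesis by (subst (asm) prob_Collect_eq_1) auto
qed

text \<open>
  The functions \<open>K sqrt (K\<^sup>2 + x\<^sup>2) - K\<^sup>2\<close> are Lipschitz and lie below \<open>x\<^sup>2 / 2\<close> by AM-GM, and their
  derivatives tend to \<open>x\<close> as \<open>K \<rightarrow> \<infinity>\<close>.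
\<close>

lemma integrable_We:
  assumes W2: "integrable M (\<lambda>\<omega>. (W \<omega>)\<^sup>2)"
  shows "integrable M We"
proof -
  define f where "f = (\<lambda>n x. real (Suc n) * sqrt ((real (Suc n))\<^sup>2 + x\<^sup>2) - (real (Suc n))\<^sup>2)"
  define f' where "f' = (\<lambda>n x. real (Suc n) * (x / sqrt ((real (Suc n))\<^sup>2 + x\<^sup>2)))"
  have pos: "0 < (real (Suc n))\<^sup>2 + x\<^sup>2" for n x
    by (intro add_pos_nonneg) auto
  have D: "(f n has_real_derivative f' n x) (at x)" for n x
    unfolding f_def f'_def using pos[of n x] by (auto intro!: derivative_eq_intros simp: field_simps)
  have [measurable]: "f' n \<in> borel_measurable borel" for n unfolding f'_def by measurable
  have f'_bound: "\<bar>f' n x\<bar> \<le> real (Suc n)" for n x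
  proof -
    have "\<bar>x\<bar> \<le> sqrt ((real (Suc n))\<^sup>2 + x\<^sup>2)" by (rule real_le_rsqrt) simp
    then have "\<bar>x\<bar> / sqrt ((real (Suc n))\<^sup>2 + x\<^sup>2) \<le> 1" using pos[of n x] by simp
    then have "real (Suc n) * (\<bar>x\<bar> / sqrt ((real (Suc n))\<^sup>2 + x\<^sup>2)) \<le> real (Suc n) * 1"
      by (intro mult_left_mono) auto
    then show ?thesis unfolding f'_def by (simp add: abs_mult)
  qed
  have lip: "(real (Suc n))-lipschitz_on UNIV (f n)" for n
    by (rule lipschitz_on_of_real_derivative[OF D f'_bound])
  have f0: "f n 0 = 0" for n by (simp add: f_def power2_eq_square)
  have f_le: "f n x \<le> x\<^sup>2 / 2" for n x
  proof -
    have "0 \<le> (sqrt ((real (Suc n))\<^sup>2 + x\<^sup>2) - real (Suc n))\<^sup>2" by simp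
    also have "\<dots> = ((real (Suc n))\<^sup>2 + x\<^sup>2) + (real (Suc n))\<^sup>2
        - 2 * (real (Suc n) * sqrt ((real (Suc n))\<^sup>2 + x\<^sup>2))"
      unfolding power2_diff using pos[of n x] by simp
    finally show ?thesis unfolding f_def by simp
  qed
  have lim: "(\<lambda>n. f' n x) \<longlonglongrightarrow> x" for x
    unfolding f'_def by real_asymp
  have bound: "(\<integral>\<^sup>+\<omega>. ennreal (f' n (We \<omega>)) \<partial>M) \<le> ennreal (expectation (\<lambda>\<omega>. (W \<omega>)\<^sup>2 / 2))" for n
  proof -
    have "integrable M (\<lambda>\<omega>. f' n (We \<omega>))"
      by (rule integrable_const_bound[of _ "real (Suc n)"]) (use f'_bound in auto)
    then have "(\<integral>\<^sup>+\<omega>. ennreal (f' n (We \<omega>)) \<partial>M) = ennreal (expectation (\<lambda>\<omega>. f' n (We \<omega>)))"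
    proof (rule nn_integral_eq_integral)
      \<comment> \<open>\<open>f' n x\<close> has the sign of \<open>x\<close>, so positivity of
        \<open>We\<close> ensures that \<open>ennreal\<close> cuts nothing off.\<close>
      show "AE \<omega> in M. 0 \<le> f' n (We \<omega>)"
        using We_pos by eventually_elim (auto simp: f'_def)
    qed
    also have "expectation (\<lambda>\<omega>. f' n (We \<omega>)) = expectation (\<lambda>\<omega>. f n (W \<omega>))"
      using expectation_eq_derivative[OF lip _ D] f0 by simp
    also have "\<dots> \<le> expectation (\<lambda>\<omega>. (W \<omega>)\<^sup>2 / 2)"
      by (intro integral_mono integrable_lipschitz_W[OF lip] f_le) (use W2 in auto)
    finally show ?thesis by (simp add: ennreal_leI)
  qed
  \<comment> \<open>Fatou's lemma: the bound by half the second moment of \<open>W\<close> is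
    uniform in \<open>n\<close> and passes to the limit.\<close>
  have "(\<integral>\<^sup>+\<omega>. ennreal (We \<omega>) \<partial>M) = (\<integral>\<^sup>+\<omega>. liminf (\<lambda>n. ennreal (f' n (We \<omega>))) \<partial>M)"
    by (intro nn_integral_cong lim_imp_Liminf[symmetric] tendsto_ennrealI lim) simp
  also have "\<dots> \<le> liminf (\<lambda>n. \<integral>\<^sup>+\<omega>. ennreal (f' n (We \<omega>)) \<partial>M)"
    by (rule nn_integral_liminf) measurable
  also have "\<dots> \<le> liminf (\<lambda>n. ennreal (expectation (\<lambda>\<omega>. (W \<omega>)\<^sup>2 / 2)))"
    by (intro Liminf_mono always_eventually allI bound)
  also have "\<dots> < \<infinity>" by (simp add: Liminf_const)
  finally have "(\<integral>\<^sup>+\<omega>. ennreal (We \<omega>) \<partial>M) < \<infinity>" .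
  moreover have "AE \<omega> in M. 0 \<le> We \<omega>" using We_pos by eventually_elim simp
  ultimately show ?thesis by (intro integrableI_nonneg) auto
qed

section \<open>Kolmogorov bounds\<close>

text \<open>For Z distributed as Exp(1), \<open>f x\<close> is the probability that
  \<open>x + Z > z\<close>, that is, the Stein solution for the indicator of \<open>{..z}\<close> up
  to the additive constant \<open>f 0 = exp (- z)\<close>.\<close>

lemma stein_cdf_We:
  assumes z: "0 \<le> z"
  defines "f \<equiv> \<lambda>x. exp (- max 0 (z - x))"
  shows "prob {\<omega> \<in> space M. We \<omega> \<le> z} - (1 - exp (- z))
      = expectation (\<lambda>\<omega>. f (W \<omega>) - f (We \<omega>))"
    and "\<bar>f x - f y\<bar> \<le> 1" and "\<bar>f x - f y\<bar> \<le> \<bar>x - y\<bar>"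
proof -
  show "\<bar>f x - f y\<bar> \<le> 1" for x y
  proof -
    have "0 < f x" "f x \<le> 1" "0 < f y" "f y \<le> 1" by (auto simp: f_def)
    then show ?thesis by linarith
  qed
  show lip': "\<bar>f x - f y\<bar> \<le> \<bar>x - y\<bar>" for x y
  proof (induction x y rule: linorder_wlog)
    case (le x y)
    have mono: "max 0 (z - y) \<le> max 0 (z - x)" using le by (auto simp: max_def)
    then have "f x \<le> f y" by (simp add: f_def)
    moreover have "f y - f x \<le> max 0 (z - x) - max 0 (z - y)"
      unfolding f_def by (rule exp_uminus_diff_le[OF _ mono]) simp
    ultimately show ?case using le by (auto simp: max_def split: if_splits)
  qed (simp add: abs_minus_commute)
  have lip: "1-lipschitz_on UNIV f"
    by (rule lipschitz_onI) (use lip' in \<open>auto simp: dist_real_def\<close>)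
  have [measurable]: "f \<in> borel_measurable borel" unfolding f_def by measurable
  \<comment> \<open>The slope is \<open>f x\<close> left of \<open>z\<close> and 0 right of it.
    Since \<open>f x = 1\<close> on the right, this one formula covers both sides.\<close>
  let ?f' = "\<lambda>x. f x - 1 + indicator {..z} x"
  have D: "(f has_real_derivative ?f' x) (at x)" if "x \<noteq> z" for x
  proof (cases "x < z")
    case True
    have "((\<lambda>x. exp (x - z)) has_real_derivative ?f' x) (at x)"
      using True by (auto intro!: derivative_eq_intros simp: f_def)
    then show ?thesis
      by (rule has_field_derivative_transform_within_open[of _ _ _ "{..<z}"])
        (use True in \<open>auto simp: f_def\<close>)
  next
    case False
    then have "z < x" using that by simp
    then have "((\<lambda>x. 1) has_real_derivative ?f' x) (at x)" by (simp add: f_def)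
    then show ?thesis
      by (rule has_field_derivative_transform_within_open[of _ _ _ "{z<..}"])
        (use \<open>z < x\<close> in \<open>auto simp: f_def\<close>)
  qed
  have int: "integrable M (\<lambda>\<omega>. f (X \<omega>))" if [measurable]: "X \<in> borel_measurable M" for X
    by (rule integrable_const_bound[of _ 1]) (auto simp: f_def)
  have eq: "expectation (\<lambda>\<omega>. f (W \<omega>)) - f 0
      = expectation (\<lambda>\<omega>. f (We \<omega>) - 1 + indicator {..z} (We \<omega>))"
    by (rule expectation_eq_derivative[OF lip _ D]) auto
  have ind: "expectation (\<lambda>\<omega>. indicat_real {..z} (We \<omega>)) = prob {\<omega> \<in> space M. We \<omega> \<le> z}"
  proof -
    have "expectation (\<lambda>\<omega>. indicat_real {..z} (We \<omega>))
        = expectation (indicat_real {\<omega> \<in> space M. We \<omega> \<le> z})"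
      by (intro Bochner_Integration.integral_cong) (auto simp: indicator_def)
    then show ?thesis by simp
  qed
  have "integrable M (\<lambda>\<omega>. indicat_real {..z} (We \<omega>))"
    by (rule integrable_const_bound[of _ 1]) (auto simp: indicator_def)
  then have "expectation (\<lambda>\<omega>. f (We \<omega>) - 1 + indicator {..z} (We \<omega>))
      = expectation (\<lambda>\<omega>. f (We \<omega>)) - 1 + prob {\<omega> \<in> space M. We \<omega> \<le> z}"
    using int[OF We_meas] ind prob_space by simp
  then show "prob {\<omega> \<in> space M. We \<omega> \<le> z} - (1 - exp (- z))
      = expectation (\<lambda>\<omega>. f (W \<omega>) - f (We \<omega>))"
    using eq int[OF W_meas] int[OF We_meas] z by (simp add: f_def)
qed

text \<open>The increment of the Stein solution is at most 1 and at most
  \<open>\<bar>We \<omega> - W \<omega>\<bar>\<close>, so any integrable majorant \<open>B\<close>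
  of the minimum of the two yields a bound; different choices of \<open>B\<close> give the
  probability bound and the expectation bound. For \<open>z < 0\<close> both distribution functions
  vanish.\<close>

lemma cdf_We_bound:
  assumes B: "integrable M B"
    and le: "\<And>\<omega> t. 0 \<le> t \<Longrightarrow> t \<le> 1 \<Longrightarrow> t \<le> \<bar>We \<omega> - W \<omega>\<bar> \<Longrightarrow> t \<le> B \<omega>"
  shows "\<bar>prob {\<omega> \<in> space M. We \<omega> \<le> z} - measure Exp1 {..z}\<bar> \<le> expectation B"
proof (cases "z < 0")
  case True
  have "AE \<omega> in M. \<not> We \<omega> \<le> z"
    using We_pos by eventually_elim (use True in auto)
  then have "prob {\<omega> \<in> space M. We \<omega> \<le> z} = 0"
    by (subst prob_Collect_eq_0) auto
  moreover have "0 \<le> expectation B" using le[of 0] by (intro Bochner_Integration.integral_nonneg) auto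
  ultimately show ?thesis using True by (simp add: measure_Exp1_atMost)
next
  case False
  then have z: "0 \<le> z" by simp
  let ?f = "\<lambda>x. exp (- max 0 (z - x))"
  have "\<bar>prob {\<omega> \<in> space M. We \<omega> \<le> z} - measure Exp1 {..z}\<bar>
      = \<bar>expectation (\<lambda>\<omega>. ?f (W \<omega>) - ?f (We \<omega>))\<bar>"
    using stein_cdf_We(1)[OF z] False by (simp add: measure_Exp1_atMost)
  also have "\<dots> \<le> expectation (\<lambda>\<omega>. \<bar>?f (W \<omega>) - ?f (We \<omega>)\<bar>)"
    by (rule integral_abs_bound)
  also have "\<dots> \<le> expectation B"
  proof (rule integral_mono[OF _ B])
    show "integrable M (\<lambda>\<omega>. \<bar>?f (W \<omega>) - ?f (We \<omega>)\<bar>)"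
      by (rule integrable_const_bound[of _ 1]) (use stein_cdf_We(2)[OF z] in auto)
    show "\<bar>?f (W \<omega>) - ?f (We \<omega>)\<bar> \<le> B \<omega>" for \<omega>
      using stein_cdf_We(2,3)[OF z, of "W \<omega>" "We \<omega>"]
      by (intro le) (auto simp: abs_minus_commute)
  qed
  finally show ?thesis .
qed

lemma d_K_law_le:
  assumes [measurable]: "X \<in> borel_measurable M"
    and "\<And>z. \<bar>prob {\<omega> \<in> space M. X \<omega> \<le> z} - measure Exp1 {..z}\<bar> \<le> c"
  shows "d_K (law M X) Exp1 \<le> ennreal c"
proof -
  have "measure (law M X) {..z} = prob {\<omega> \<in> space M. X \<omega> \<le> z}" for z
    unfolding law_def by (subst measure_distr) (auto intro!: arg_cong[where f = prob])
  then show ?thesis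
    using assms(2) unfolding d_K_def test_dist_def kolmogorov_class_def
    by (auto intro!: SUP_least ennreal_leI simp: law_def)
qed

text \<open>Majorant: \<open>\<beta>\<close> where the coupling is \<open>\<beta>\<close>-close, and
  \<open>\<beta> + 1\<close>, hence at least 1, elsewhere.\<close>

lemma cdf_We_bound_prob:
  assumes "0 < \<beta>"
  shows "\<bar>prob {\<omega> \<in> space M. We \<omega> \<le> z} - measure Exp1 {..z}\<bar>
    \<le> \<beta> + \<P>(\<omega> in M. \<bar>We \<omega> - W \<omega>\<bar> > \<beta>)"
proof -
  let ?A = "{\<omega> \<in> space M. \<bar>We \<omega> - W \<omega>\<bar> > \<beta>}"
  have "\<bar>prob {\<omega> \<in> space M. We \<omega> \<le> z} - measure Exp1 {..z}\<bar>
      \<le> expectation (\<lambda>\<omega>. \<beta> + indicator {x. \<bar>x\<bar> > \<beta>} (We \<omega> - W \<omega>))"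
  proof (rule cdf_We_bound)
    show "integrable M (\<lambda>\<omega>. \<beta> + indicator {x. \<bar>x\<bar> > \<beta>} (We \<omega> - W \<omega>))"
      by (rule integrable_const_bound[of _ "\<beta> + 1"]) (use assms in \<open>auto simp: indicator_def\<close>)
  qed (use assms in \<open>auto simp: indicator_def\<close>)
  also have "\<dots> = expectation (\<lambda>\<omega>. \<beta> + indicator ?A \<omega>)"
    by (intro Bochner_Integration.integral_cong) (auto simp: indicator_def)
  also have "\<dots> = \<beta> + prob ?A"
    using prob_space by (subst Bochner_Integration.integral_add) (auto simp: emeasure_eq_measure)
  finally show ?thesis .
qed

lemma cdf_W_bound_prob:
  assumes b: "0 < \<beta>"
  shows "\<bar>prob {\<omega> \<in> space M. W \<omega> \<le> z} - measure Exp1 {..z}\<bar>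
    \<le> 2 * \<beta> + 2 * \<P>(\<omega> in M. \<bar>We \<omega> - W \<omega>\<bar> > \<beta>)"
proof -
  let ?A = "{\<omega> \<in> space M. \<bar>We \<omega> - W \<omega>\<bar> > \<beta>}"
  have "prob {\<omega> \<in> space M. W \<omega> \<le> z} \<le> prob ({\<omega> \<in> space M. We \<omega> \<le> z + \<beta>} \<union> ?A)"
    by (intro finite_measure_mono) auto
  also have "\<dots> \<le> prob {\<omega> \<in> space M. We \<omega> \<le> z + \<beta>} + prob ?A"
    by (intro measure_Un_le) auto
  finally have up: "prob {\<omega> \<in> space M. W \<omega> \<le> z} \<le> prob {\<omega> \<in> space M. We \<omega> \<le> z + \<beta>} + prob ?A" .
  have "prob {\<omega> \<in> space M. We \<omega> \<le> z - \<beta>} \<le> prob ({\<omega> \<in> space M. W \<omega> \<le> z} \<union> ?A)"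
    by (intro finite_measure_mono) auto
  also have "\<dots> \<le> prob {\<omega> \<in> space M. W \<omega> \<le> z} + prob ?A"
    by (intro measure_Un_le) auto
  finally have lo: "prob {\<omega> \<in> space M. We \<omega> \<le> z - \<beta>} \<le> prob {\<omega> \<in> space M. W \<omega> \<le> z} + prob ?A" .
  \<comment> \<open>One \<open>\<beta>\<close> and one \<open>prob ?A\<close> come from the bound
    for \<open>We\<close> at \<open>z + \<beta>\<close> or \<open>z - \<beta>\<close>; the other
    \<open>\<beta>\<close> pays for moving the argument of the Exp(1) distribution function back to
    \<open>z\<close>, the other \<open>prob ?A\<close> for replacing \<open>W\<close> by
    \<open>We\<close>.\<close>
  show ?thesis
    using up lo cdf_We_bound_prob[OF b, of "z + \<beta>"] cdf_We_bound_prob[OF b, of "z - \<beta>"]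
      measure_Exp1_atMost_shift[of \<beta> z] measure_Exp1_atMost_shift[of \<beta> "z - \<beta>"] b
    unfolding abs_le_iff diff_add_cancel by linarith
qed

section \<open>Wasserstein bounds\<close>

lemma abs_expectation_diff_le:
  fixes f :: "real \<Rightarrow> real"
  assumes We_int: "integrable M We" and f: "C-lipschitz_on UNIV f"
  shows "\<bar>expectation (\<lambda>\<omega>. f (We \<omega>)) - expectation (\<lambda>\<omega>. f (W \<omega>))\<bar>
    \<le> C * expectation (\<lambda>\<omega>. \<bar>We \<omega> - W \<omega>\<bar>)"
proof -
  have int: "integrable M (\<lambda>\<omega>. f (We \<omega>))" "integrable M (\<lambda>\<omega>. f (W \<omega>))"
    using integrable_lipschitz_comp[OF finite_measure_axioms f] We_int W_int by auto
  have "\<bar>expectation (\<lambda>\<omega>. f (We \<omega>)) - expectation (\<lambda>\<omega>. f (W \<omega>))\<bar>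
      = \<bar>expectation (\<lambda>\<omega>. f (We \<omega>) - f (W \<omega>))\<bar>" using int by simp
  also have "\<dots> \<le> expectation (\<lambda>\<omega>. \<bar>f (We \<omega>) - f (W \<omega>)\<bar>)" by (rule integral_abs_bound)
  also have "\<dots> \<le> expectation (\<lambda>\<omega>. C * \<bar>We \<omega> - W \<omega>\<bar>)"
    using int W_int We_int lipschitz_onD[OF f]
    by (intro integral_mono) (auto simp: dist_real_def)
  finally show ?thesis by simp
qed

context
  fixes h :: "real \<Rightarrow> real"
  assumes h: "1-lipschitz_on UNIV h" and We_int: "integrable M We"
begin

text \<open>The equilibrium identity applied to \<open>exp_shift h\<close>, whose derivative is
  \<open>exp_shift h x - h x\<close>. Integrability of \<open>We\<close> allows the expectation to
  be split.\<close>

lemma expectation_exp_shift: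
  "expectation (\<lambda>\<omega>. exp_shift h (W \<omega>)) - exp_shift h 0
    = expectation (\<lambda>\<omega>. exp_shift h (We \<omega>)) - expectation (\<lambda>\<omega>. h (We \<omega>))"
proof -
  have [measurable]: "h \<in> borel_measurable borel" "exp_shift h \<in> borel_measurable borel"
    using measurable_lipschitz[OF h] measurable_lipschitz[OF lipschitz_exp_shift[OF h]] by auto
  have "expectation (\<lambda>\<omega>. exp_shift h (W \<omega>)) - exp_shift h 0
      = expectation (\<lambda>\<omega>. exp_shift h (We \<omega>) - h (We \<omega>))"
    by (rule expectation_eq_derivative[OF lipschitz_exp_shift[OF h] _ exp_shift_has_derivative[OF h]])
      measurable
  then show ?thesis
    using integrable_lipschitz_comp[OF finite_measure_axioms _ We_int] h lipschitz_exp_shift[OF h]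
    by simp
qed

text \<open>As \<open>exp_shift h 0\<close> is the Exp(1)-integral of \<open>h\<close>, the
  preceding identity turns the left side into a difference of expectations of the 1-Lipschitz
  \<open>exp_shift h\<close> at \<open>We\<close> and \<open>W\<close>.\<close>

lemma wasserstein_We:
  "\<bar>expectation (\<lambda>\<omega>. h (We \<omega>)) - (\<integral>x. h x \<partial>Exp1)\<bar> \<le> expectation (\<lambda>\<omega>. \<bar>We \<omega> - W \<omega>\<bar>)"
  using abs_expectation_diff_le[OF We_int lipschitz_exp_shift[OF h]] expectation_exp_shift
  by (simp add: exp_shift_def[of h 0])

lemma wasserstein_W:
  "\<bar>expectation (\<lambda>\<omega>. h (W \<omega>)) - (\<integral>x. h x \<partial>Exp1)\<bar> \<le> 2 * expectation (\<lambda>\<omega>. \<bar>We \<omega> - W \<omega>\<bar>)"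
  using wasserstein_We abs_expectation_diff_le[OF We_int h] by linarith

end

lemma d_W_law_le:
  assumes [measurable]: "X \<in> borel_measurable M"
    and le: "\<And>h. 1-lipschitz_on UNIV h \<Longrightarrow> \<bar>expectation (\<lambda>\<omega>. h (X \<omega>)) - (\<integral>x. h x \<partial>Exp1)\<bar> \<le> c"
  shows "d_W (law M X) Exp1 \<le> ennreal c"
  unfolding d_W_def test_dist_def wasserstein_class_def
proof (intro SUP_least ennreal_leI)
  fix h :: "real \<Rightarrow> real" assume "h \<in> {h. 1-lipschitz_on UNIV h}"
  then have h: "1-lipschitz_on UNIV h" by simp
  have "(\<integral>x. h x \<partial>law M X) = expectation (\<lambda>\<omega>. h (X \<omega>))"
    unfolding law_def by (intro integral_distr) (use measurable_lipschitz[OF h] in auto)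
  then show "\<bar>(\<integral>x. h x \<partial>law M X) - (\<integral>x. h x \<partial>Exp1)\<bar> \<le> c" using le[OF h] by simp
qed

end

theorem theorem2p1:
  fixes M :: "'a measure" and W We :: "'a \<Rightarrow> real"
  assumes "prob_space M"
    and "W \<in> borel_measurable M"
    and "AE \<omega> in M. 0 \<le> W \<omega>"
    and "integrable M W"
    and "(\<integral>\<omega>. W \<omega> \<partial>M) = 1"
    and "We \<in> borel_measurable M"
    and "has_equilibrium_distribution M We M W"
  shows "(\<forall>\<beta>>0.
            d_K (law M W) Exp1 \<le> ennreal (12 * \<beta> + 2 * \<P>(\<omega> in M. \<bar>We \<omega> - W \<omega>\<bar> > \<beta>)) \<and>
            d_K (law M We) Exp1 \<le> ennreal (\<beta> + \<P>(\<omega> in M. \<bar>We \<omega> - W \<omega>\<bar> > \<beta>))) \<and>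
         (integrable M (\<lambda>\<omega>. (W \<omega>)\<^sup>2) \<longrightarrow>
            d_W (law M W) Exp1 \<le> ennreal (2 * (\<integral>\<omega>. \<bar>We \<omega> - W \<omega>\<bar> \<partial>M)) \<and>
            d_K (law M We) Exp1 \<le> ennreal (\<integral>\<omega>. \<bar>We \<omega> - W \<omega>\<bar> \<partial>M) \<and>
            d_W (law M We) Exp1 \<le> ennreal (\<integral>\<omega>. \<bar>We \<omega> - W \<omega>\<bar> \<partial>M))"
proof -
  interpret equilibrium_coupling M W We
    using assms by (simp add: equilibrium_coupling_def equilibrium_coupling_axioms_def)
  show ?thesis
  proof (intro conjI allI impI)
    fix \<beta> :: real assume b: "0 < \<beta>"
    show "d_K (law M W) Exp1 \<le> ennreal (12 * \<beta> + 2 * \<P>(\<omega> in M. \<bar>We \<omega> - W \<omega>\<bar> > \<beta>))"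
    proof (rule d_K_law_le[OF W_meas])
      fix z
      show "\<bar>prob {\<omega> \<in> space M. W \<omega> \<le> z} - measure Exp1 {..z}\<bar>
          \<le> 12 * \<beta> + 2 * \<P>(\<omega> in M. \<bar>We \<omega> - W \<omega>\<bar> > \<beta>)"
        \<comment> \<open>The bound with \<open>2 * \<beta>\<close> is weakened to
          \<open>12 * \<beta>\<close>.\<close>
        using cdf_W_bound_prob[OF b, of z] b by linarith
    qed
    show "d_K (law M We) Exp1 \<le> ennreal (\<beta> + \<P>(\<omega> in M. \<bar>We \<omega> - W \<omega>\<bar> > \<beta>))"
      by (rule d_K_law_le[OF We_meas cdf_We_bound_prob[OF b]])
  next
    assume "integrable M (\<lambda>\<omega>. (W \<omega>)\<^sup>2)"
    \<comment> \<open>The second moment enters here: it makes \<open>We\<close>, and hence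
      \<open>\<bar>We \<omega> - W \<omega>\<bar>\<close>, integrable.\<close>
    note We_int = integrable_We[OF this]
    show "d_W (law M W) Exp1 \<le> ennreal (2 * (\<integral>\<omega>. \<bar>We \<omega> - W \<omega>\<bar> \<partial>M))"
      by (rule d_W_law_le[OF W_meas wasserstein_W[OF _ We_int]])
    show "d_W (law M We) Exp1 \<le> ennreal (\<integral>\<omega>. \<bar>We \<omega> - W \<omega>\<bar> \<partial>M)"
      by (rule d_W_law_le[OF We_meas wasserstein_We[OF _ We_int]])
    show "d_K (law M We) Exp1 \<le> ennreal (\<integral>\<omega>. \<bar>We \<omega> - W \<omega>\<bar> \<partial>M)"
      \<comment> \<open>Here the majorant \<open>B\<close> is
        \<open>\<bar>We \<omega> - W \<omega>\<bar>\<close> itself.\<close>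
      by (rule d_K_law_le[OF We_meas cdf_We_bound]) (use We_int W_int in auto)
  qed
qed

end
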